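(* Let $\omega(x,y)=-\omega(y,x)$ be a skew-symmetric kernel and $\rho$ a weight function on $\mathbb{R}$ such that the integrals $$\mu_{i,j}^{k,l}=\iint_{\mathbb{R}^2}x^{k-i}y^{k-j}(1+x)^l(1+y)^l\omega(x,y)\rho(x)\rho(y)\,dx\,dy,\qquad \beta_i^{k,l}=\int_{\mathbb{R}}x^{k-i}(1+x)^l\rho(x)\,dx$$ converge absolutely for all integers $i,j,k$ and all integers $l\ge 0$. Put $$\tau_{2n}^{k,l}=Pf(0,1,\dots,2n-1)^{k,l},\qquad \tau_{2n+1}^{k,l}=Pf(d_0,0,1,\dots,2n)^{k,l},$$ assume all $\tau_n^{k,l}$ ($n,k,l\ge 0$) are nonzero, and define polynomials in $z$ $$P_{2n}^{k,l}(z)=\frac{z^{2n}}{\tau_{2n}^{k,l}}Pf(0,1,\dots,2n,z)^{k,l},\qquad P_{2n+1}^{k,l}(z)=\frac{z^{2n+1}}{\tau_{2n+1}^{k,l}}Pf(d_0,0,1,\dots,2n+1,z)^{k,l},$$ with Pfaffian entries $Pf(i,j)^{k,l}=\mu_{i,j}^{k,l}$, $Pf(d_0,i)^{k,l}=\beta_i^{k,l}$, $Pf(i,z)^{k,l}=z^{-i}$, $Pf(d_0,z)^{k,l}=0$. Then for all integers $n\ge 0$, $k\ge 1$, $l\ge 0$, $$P_{n+1}^{k,l}=(z+1)P_n^{k-1,l+1}-z\,\frac{\tau_n^{k,l}\tau_{n+1}^{k-1,l+1}}{\tau_n^{k-1,l+1}\tau_{n+1}^{k,l}}P_n^{k,l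}+z(z+1)\frac{\tau_{n+2}^{k,l}\tau_{n-1}^{k-1,l+1}}{\tau_n^{k-1,l+1}\tau_{n+1}^{k,l}}P_{n-1}^{k-1,l+1}.$$
   Context: Hirota's Pfaffian notation: given symbols $a_1,\dots,a_{2N}$ and prescribed entries $Pf(a_i,a_j)=-Pf(a_j,a_i)$, $Pf(a_1,\dots,a_{2N})$ denotes the Pfaffian of the $2N\times 2N$ skew-symmetric matrix with $(i,j)$ entry $Pf(a_i,a_j)$; the empty Pfaffian is $1$. Superscripts on $Pf$ indicate that the entries with those superscripts are used. Conventions: $\tau_0^{k,l}=1$, $\tau_{-1}^{k,l}=0$, $P_0^{k,l}=1$, $P_{-1}^{k,l}=0$. *)

theory Defs
  imports "HOL-Analysis.Analysis" "HOL-Computational_Algebra.Polynomial"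
begin

text \<open>The Pfaffian of a skew-symmetric \<open>2N \<times> 2N\<close> matrix with rows and columns indexed by
  \<open>0, \<dots>, 2N - 1\<close>. Every perfect matching is counted \<open>2\<^sup>N N!\<close> times by the permutations.\<close>

definition pfaffian :: "nat \<Rightarrow> (nat \<Rightarrow> nat \<Rightarrow> real) \<Rightarrow> real" where
  "pfaffian N A =
     (\<Sum>\<sigma> | \<sigma> permutes {..<2 * N}. of_int (sign \<sigma>) * (\<Prod>i<N. A (\<sigma> (2 * i)) (\<sigma> (2 * i + 1))))
       / (2 ^ N * fact N)"

text \<open>Hirota's \<open>Pf(a\<^sub>1, \<dots>, a\<^sub>2\<^sub>N)\<close>, for prescribed entries \<open>e\<close>.\<close>

definition hirota_pf :: "('s \<Rightarrow> 's \<Rightarrow> real) \<Rightarrow> 's list \<Rightarrow> real" where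
  "hirota_pf e as = pfaffian (length as div 2) (\<lambda>i j. e (as ! i) (as ! j))"

text \<open>Integer powers of \<open>0\<close> with negative exponent are \<open>0\<close> in HOL; this concerns only the null sets
  \<open>x = 0\<close> and \<open>y = 0\<close>.\<close>

definition mu_integrand ::
    "(real \<Rightarrow> real \<Rightarrow> real) \<Rightarrow> (real \<Rightarrow> real) \<Rightarrow> int \<Rightarrow> int \<Rightarrow> int \<Rightarrow> nat \<Rightarrow> real \<times> real \<Rightarrow> real" where
  "mu_integrand \<omega> \<rho> i j k l = (\<lambda>(x, y).
     x powi (k - i) * y powi (k - j) * (1 + x) ^ l * (1 + y) ^ l * \<omega> x y * \<rho> x * \<rho> y)"

definition beta_integrand :: "(real \<Rightarrow> real) \<Rightarrow> int \<Rightarrow> int \<Rightarrow> nat \<Rightarrow> real \<Rightarrow> real" where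
  "beta_integrand \<rho> i k l = (\<lambda>x. x powi (k - i) * (1 + x) ^ l * \<rho> x)"

definition mu :: "(real \<Rightarrow> real \<Rightarrow> real) \<Rightarrow> (real \<Rightarrow> real) \<Rightarrow> int \<Rightarrow> int \<Rightarrow> int \<Rightarrow> nat \<Rightarrow> real" where
  "mu \<omega> \<rho> i j k l = integral\<^sup>L lebesgue (mu_integrand \<omega> \<rho> i j k l)"

definition beta :: "(real \<Rightarrow> real) \<Rightarrow> int \<Rightarrow> int \<Rightarrow> nat \<Rightarrow> real" where
  "beta \<rho> i k l = integral\<^sup>L lebesgue (beta_integrand \<rho> i k l)"

text \<open>The symbols \<open>d\<^sub>0\<close>, \<open>i\<close> and \<open>z\<close>; the last one carries the number \<open>z\<close>.\<close>

datatype symbol = D0 | Idx int | Zsym real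

fun entry :: "(real \<Rightarrow> real \<Rightarrow> real) \<Rightarrow> (real \<Rightarrow> real) \<Rightarrow> int \<Rightarrow> nat \<Rightarrow> symbol \<Rightarrow> symbol \<Rightarrow> real" where
  "entry \<omega> \<rho> k l (Idx i) (Idx j) = mu \<omega> \<rho> i j k l"
| "entry \<omega> \<rho> k l D0 (Idx i) = beta \<rho> i k l"
| "entry \<omega> \<rho> k l (Idx i) D0 = - beta \<rho> i k l"
| "entry \<omega> \<rho> k l (Idx i) (Zsym z) = z powi (- i)"
| "entry \<omega> \<rho> k l (Zsym z) (Idx i) = - (z powi (- i))"
| "entry \<omega> \<rho> k l _ _ = 0"

text \<open>The symbols \<open>0, \<dots>, n\<close>, preceded by \<open>d\<^sub>0\<close> according to the parity of \<open>m\<close>.\<close>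

definition symbols :: "int \<Rightarrow> int \<Rightarrow> symbol list" where
  "symbols m n = (if even m then [] else [D0]) @ map Idx [0..n]"

text \<open>The index \<open>n\<close> is an integer in order to accommodate the conventions \<open>\<tau>\<^sub>-\<^sub>1 = 0\<close> and \<open>P\<^sub>-\<^sub>1 = 0\<close>
  (the value at indices below \<open>-1\<close> is irrelevant).\<close>

definition tau :: "(real \<Rightarrow> real \<Rightarrow> real) \<Rightarrow> (real \<Rightarrow> real) \<Rightarrow> int \<Rightarrow> int \<Rightarrow> nat \<Rightarrow> real" where
  "tau \<omega> \<rho> n k l = (if n < 0 then 0 else hirota_pf (entry \<omega> \<rho> k l) (symbols n (n - 1)))"

text \<open>The value at \<open>z \<noteq> 0\<close> of the expression defining \<open>P\<^sub>n\<close>.\<close>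

definition P_val ::
    "(real \<Rightarrow> real \<Rightarrow> real) \<Rightarrow> (real \<Rightarrow> real) \<Rightarrow> int \<Rightarrow> int \<Rightarrow> nat \<Rightarrow> real \<Rightarrow> real" where
  "P_val \<omega> \<rho> n k l z =
     z powi n / tau \<omega> \<rho> n k l * hirota_pf (entry \<omega> \<rho> k l) (symbols n n @ [Zsym z])"

text \<open>\<open>P\<^sub>n\<close> is the polynomial in \<open>z\<close> to which that expression, in which negative powers of \<open>z\<close>
  occur, simplifies. It exists and is unique, see \<open>P_poly_unique\<close> below.\<close>

definition P_poly :: "(real \<Rightarrow> real \<Rightarrow> real) \<Rightarrow> (real \<Rightarrow> real) \<Rightarrow> int \<Rightarrow> int \<Rightarrow> nat \<Rightarrow> real poly" where
  "P_poly \<omega> \<rho> n k l =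
     (if n < 0 then 0 else (THE p. \<forall>z. z \<noteq> 0 \<longrightarrow> poly p z = P_val \<omega> \<rho> n k l z))"

definition polylike :: "(real \<Rightarrow> real) \<Rightarrow> bool" where
  "polylike f \<longleftrightarrow> (\<exists>p. \<forall>z. z \<noteq> 0 \<longrightarrow> poly p z = f z)"

lemma polylike_const: "polylike (\<lambda>z. c)"
  unfolding polylike_def by (rule exI[of _ "[:c:]"]) simp

lemma polylike_mult: "polylike f \<Longrightarrow> polylike g \<Longrightarrow> polylike (\<lambda>z. f z * g z)"
  unfolding polylike_def by (metis poly_mult)

lemma polylike_sum:
  "(\<And>s. s \<in> S \<Longrightarrow> polylike (f s)) \<Longrightarrow> polylike (\<lambda>z. \<Sum>s\<in>S. f s z)"
proof (induction S rule: infinite_finite_induct)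
  case (insert x F)
  then obtain p q where "\<forall>z. z \<noteq> 0 \<longrightarrow> poly p z = f x z" "\<forall>z. z \<noteq> 0 \<longrightarrow> poly q z = (\<Sum>s\<in>F. f s z)"
    unfolding polylike_def by (metis insertCI)
  with insert.hyps show ?case
    unfolding polylike_def by (intro exI[of _ "p + q"]) simp
qed (simp_all add: polylike_const)

lemma polylike_entry:
  assumes "a \<in> set (symbols n n)"
  shows "polylike (\<lambda>z. z powi n * entry \<omega> \<rho> k l a (Zsym z))"
    and "polylike (\<lambda>z. z powi n * entry \<omega> \<rho> k l (Zsym z) a)"
proof -
  have *: "\<forall>z::real. z \<noteq> 0 \<longrightarrow> poly (monom 1 (nat (n - i))) z = z powi n * z powi (- i)"
    if "0 \<le> i" "i \<le> n" for i :: int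
  proof (intro allI impI)
    fix z :: real assume "z \<noteq> 0"
    then have "z powi n * z powi (- i) = z powi (n - i)"
      using power_int_add[of z n "- i"] by simp
    also have "\<dots> = z ^ nat (n - i)"
      using that by (simp add: power_int_def)
    finally show "poly (monom 1 (nat (n - i))) z = z powi n * z powi (- i)"
      by (simp add: poly_monom)
  qed
  have a: "a = D0 \<or> (\<exists>i. a = Idx i \<and> 0 \<le> i \<and> i \<le> n)"
    using assms by (auto simp: symbols_def split: if_splits)
  show pos: "polylike (\<lambda>z. z powi n * entry \<omega> \<rho> k l a (Zsym z))"
  proof (cases "a = D0")
    case False
    with a obtain i where i: "a = Idx i" "0 \<le> i" "i \<le> n" by auto
    show ?thesis
      unfolding polylike_def i(1) entry.simps using *[OF i(2,3)] by blast
  qed (simp add: polylike_const)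
  have "entry \<omega> \<rho> k l (Zsym z) a = - 1 * entry \<omega> \<rho> k l a (Zsym z)" for z
    using a by auto
  then have "(\<lambda>z. z powi n * entry \<omega> \<rho> k l (Zsym z) a) =
      (\<lambda>z. - 1 * (z powi n * entry \<omega> \<rho> k l a (Zsym z)))"
    by simp
  then show "polylike (\<lambda>z. z powi n * entry \<omega> \<rho> k l (Zsym z) a)"
    using polylike_mult[OF polylike_const[of "- 1"] pos] by (simp only:)
qed

lemma polylike_P_val:
  assumes "n \<ge> 0"
  shows "polylike (P_val \<omega> \<rho> n k l)"
proof -
  let ?as = "symbols n n" and ?e = "entry \<omega> \<rho> k l"
  define M where "M = length ?as"
  define N where "N = (M + 1) div 2"
  have M: "2 * N = M + 1"
  proof -
    have "odd M"
      using assms by (auto simp: M_def symbols_def even_nat_iff)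
    then show ?thesis by (auto simp: N_def)
  qed
  define A where "A = (\<lambda>z i j. ?e ((?as @ [Zsym z]) ! i) ((?as @ [Zsym z]) ! j))"
  have A0: "A z i j = ?e (?as ! i) (?as ! j)" if "i < M" "j < M" for z i j
    using that by (simp add: A_def M_def nth_append)
  have A1: "A z i M = ?e (?as ! i) (Zsym z)" "A z M i = ?e (Zsym z) (?as ! i)" if "i < M" for z i
    using that by (simp_all add: A_def M_def nth_append)
  have summand: "polylike (\<lambda>z. z powi n * (\<Prod>i<N. A z (\<sigma> (2 * i)) (\<sigma> (2 * i + 1))))"
    if \<sigma>: "\<sigma> permutes {..<2 * N}" for \<sigma>
  proof -
    have inj: "inj \<sigma>" using \<sigma> by (rule permutes_inj)
    have lt: "\<sigma> j < M + 1" if "j < 2 * N" for j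
      using permutes_in_image[OF \<sigma>, of j] that M by simp
    obtain m where m: "m < 2 * N" "\<sigma> m = M"
      using permutes_in_image[OF \<sigma>, of "inv \<sigma> M"] permutes_inverses[OF \<sigma>] M
      by (metis lessThan_iff less_add_one)
    define i0 where "i0 = m div 2"
    have i0: "i0 < N" using m by (auto simp: i0_def)
    have lt': "\<sigma> j < M" if "j < 2 * N" "j \<noteq> m" for j
      using lt[OF that(1)] m(2) inj that(2) by (metis Suc_eq_plus1 injD less_antisym)
    have split: "(\<Prod>i<N. A z (\<sigma> (2 * i)) (\<sigma> (2 * i + 1))) =
        A z (\<sigma> (2 * i0)) (\<sigma> (2 * i0 + 1)) * (\<Prod>i\<in>{..<N} - {i0}. A z (\<sigma> (2 * i)) (\<sigma> (2 * i + 1)))" for z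
      using i0 by (intro prod.remove) auto
    have rest: "(\<Prod>i\<in>{..<N} - {i0}. A z (\<sigma> (2 * i)) (\<sigma> (2 * i + 1))) =
        (\<Prod>i\<in>{..<N} - {i0}. ?e (?as ! \<sigma> (2 * i)) (?as ! \<sigma> (2 * i + 1)))" for z
    proof (rule prod.cong[OF refl])
      fix i assume i: "i \<in> {..<N} - {i0}"
      then have "2 * i \<noteq> m" "2 * i + 1 \<noteq> m" "2 * i < 2 * N" "2 * i + 1 < 2 * N"
        by (auto simp: i0_def)
      then show "A z (\<sigma> (2 * i)) (\<sigma> (2 * i + 1)) = ?e (?as ! \<sigma> (2 * i)) (?as ! \<sigma> (2 * i + 1))"
        using lt' A0 by blast
    qed
    have in_as: "?as ! j \<in> set ?as" if "j < M" for j
      using that by (simp add: M_def)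
    have main: "polylike (\<lambda>z. z powi n * A z (\<sigma> (2 * i0)) (\<sigma> (2 * i0 + 1)))"
    proof (cases "even m")
      case True
      then have "2 * i0 = m" by (simp add: i0_def)
      moreover have "\<sigma> (2 * i0 + 1) < M" using i0 \<open>2 * i0 = m\<close> by (intro lt') auto
      ultimately show ?thesis
        using polylike_entry(2)[OF in_as] m(2) by (simp add: A1)
    next
      case False
      then have "2 * i0 + 1 = m" by (simp add: i0_def)
      moreover have "\<sigma> (2 * i0) < M" using i0 \<open>2 * i0 + 1 = m\<close> by (intro lt') auto
      ultimately show ?thesis
        using polylike_entry(1)[OF in_as] m(2) by (simp add: A1)
    qed
    show ?thesis
      unfolding split rest mult.assoc[symmetric] by (rule polylike_mult[OF main polylike_const])
  qed
  have len: "length (?as @ [Zsym z]) div 2 = N" for z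
    by (simp add: N_def M_def)
  have "P_val \<omega> \<rho> n k l =
      (\<lambda>z. 1 / (tau \<omega> \<rho> n k l * (2 ^ N * fact N)) *
        (\<Sum>\<sigma> | \<sigma> permutes {..<2 * N}. of_int (sign \<sigma>) *
          (z powi n * (\<Prod>i<N. A z (\<sigma> (2 * i)) (\<sigma> (2 * i + 1))))))"
  proof
    fix z
    have "P_val \<omega> \<rho> n k l z = z powi n / tau \<omega> \<rho> n k l *
        ((\<Sum>\<sigma> | \<sigma> permutes {..<2 * N}. of_int (sign \<sigma>) *
          (\<Prod>i<N. A z (\<sigma> (2 * i)) (\<sigma> (2 * i + 1)))) / (2 ^ N * fact N))"
      unfolding P_val_def hirota_pf_def pfaffian_def len A_def ..
    also have "\<dots> = 1 / (tau \<omega> \<rho> n k l * (2 ^ N * fact N)) * (z powi n *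
        (\<Sum>\<sigma> | \<sigma> permutes {..<2 * N}. of_int (sign \<sigma>) *
          (\<Prod>i<N. A z (\<sigma> (2 * i)) (\<sigma> (2 * i + 1)))))"
      by simp
    finally show "P_val \<omega> \<rho> n k l z = 1 / (tau \<omega> \<rho> n k l * (2 ^ N * fact N)) *
        (\<Sum>\<sigma> | \<sigma> permutes {..<2 * N}. of_int (sign \<sigma>) *
          (z powi n * (\<Prod>i<N. A z (\<sigma> (2 * i)) (\<sigma> (2 * i + 1)))))"
      by (simp only: sum_distrib_left mult.left_commute[of "z powi n"])
  qed
  moreover have "polylike \<dots>"
    by (intro polylike_mult polylike_const polylike_sum summand) simp
  ultimately show ?thesis by (simp only:)
qed

lemma P_poly_unique:
  assumes "n \<ge> 0"
  shows "\<exists>!p. \<forall>z. z \<noteq> 0 \<longrightarrow> poly p z = P_val \<omega> \<rho> n k l z"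
proof (rule ex_ex1I)
  show "\<exists>p. \<forall>z. z \<noteq> 0 \<longrightarrow> poly p z = P_val \<omega> \<rho> n k l z"
    using polylike_P_val[OF assms] unfolding polylike_def .
next
  fix p q
  assume "\<forall>z. z \<noteq> 0 \<longrightarrow> poly p z = P_val \<omega> \<rho> n k l z" "\<forall>z. z \<noteq> 0 \<longrightarrow> poly q z = P_val \<omega> \<rho> n k l z"
  then have "- {0} \<subseteq> {z. poly (p - q) z = 0}" by auto
  moreover have "infinite (- {0 :: real})"
    by (simp add: infinite_UNIV_char_0 Compl_eq_Diff_UNIV)
  ultimately have "infinite {z. poly (p - q) z = 0}"
    using finite_subset by blast
  then show "p = q"
    using poly_roots_finite[of "p - q"] by auto
qed

lemma poly_P_poly:
  assumes "n \<ge> 0" "z \<noteq> 0"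
  shows "poly (P_poly \<omega> \<rho> n k l) z = P_val \<omega> \<rho> n k l z"
  using theI'[OF P_poly_unique[OF assms(1)], of \<omega> \<rho> k l] assms by (simp add: P_poly_def)

end

theory Submission
  imports "Jordan_Normal_Form.Determinant" Defs
begin

text \<open>Write \<open>\<tau>'\<close>, \<open>P'\<close> for the objects with superscripts \<open>k - 1, l + 1\<close>. Since
  \<open>x\<^bsup>k-1-i\<^esup>(1 + x) = x\<^bsup>k-i\<^esup> + x\<^bsup>k-(i+1)\<^esup>\<close>, their Pfaffian entries at the symbol \<open>i\<close> are the entries
  with superscripts \<open>k, l\<close> at the formal sum \<open>i + (i + 1)\<close>. Let \<open>c\<close> be the symbol \<open>z\<close> at
  \<open>z = -1\<close>. Its entries with \<open>0, 1, 2, \<dots>\<close> alternate in sign, so expanding along \<open>c\<close> gives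
  \<open>\<tau>'\<^sub>n = \<plusminus> Pf(c, [d\<^sub>0,] 0, \<dots>, n)\<close> and turns \<open>(z + 1) P'\<^sub>n\<close> into a multiple of
  \<open>Pf(c, [d\<^sub>0,] 0, \<dots>, n + 1, z)\<close>. After clearing denominators the recurrence is a Pluecker relation
  between the Pfaffians obtained by adding some of \<open>c, d\<^sub>0, n + 1, z\<close> to \<open>0, \<dots>, n\<close>, namely
  the four-term relation with an even or an odd common part, according to the parity of \<open>n\<close>.\<close>

section \<open>Pfaffians\<close>

text \<open>The permutations are sorted by their value at \<open>i\<close>;
  \<open>permutation_insert i j\<close> maps the permutations of \<open>n\<close> elements
  bijectively onto the class of \<open>j\<close>. The next lemma sorts by the position of
  \<open>j\<close> instead.\<close>

lemma sum_permutes_insert_value: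
  assumes "i < Suc n"
  shows "(\<Sum>\<sigma> | \<sigma> permutes {..<Suc n}. h \<sigma>) =
    (\<Sum>j<Suc n. \<Sum>\<rho> | \<rho> permutes {..<n}. h (permutation_insert i j \<rho>))"
proof -
  have U: "{\<sigma>. \<sigma> permutes {..<Suc n}} = (\<Union>j\<in>{..<Suc n}. {\<sigma>. \<sigma> permutes {..<Suc n} \<and> \<sigma> i = j})"
    using assms by (auto simp: permutes_in_image) (metis lessThan_iff permutes_in_image)
  have "(\<Sum>\<sigma> | \<sigma> permutes {..<Suc n}. h \<sigma>) =
      (\<Sum>j<Suc n. \<Sum>\<sigma> | \<sigma> permutes {..<Suc n} \<and> \<sigma> i = j. h \<sigma>)"
    unfolding U by (rule sum.UNION_disjoint) (auto intro: finite_subset[OF _ finite_permutations])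
  also have "\<dots> = (\<Sum>j<Suc n. \<Sum>\<rho> | \<rho> permutes {..<n}. h (permutation_insert i j \<rho>))"
    using permutation_fix[OF assms] permutation_insert_inj_on[OF assms]
    by (intro sum.cong[OF refl, of "{..<Suc n}"]) (simp add: sum.reindex atLeast0LessThan)
  finally show ?thesis .
qed

lemma sum_permutes_insert_position:
  assumes "j < Suc n"
  shows "(\<Sum>\<sigma> | \<sigma> permutes {..<Suc n}. h \<sigma>) =
    (\<Sum>i<Suc n. \<Sum>\<rho> | \<rho> permutes {..<n}. h (permutation_insert i j \<rho>))"
proof -
  have U: "{\<sigma>. \<sigma> permutes {..<Suc n}} = (\<Union>i\<in>{..<Suc n}. {\<sigma>. \<sigma> permutes {..<Suc n} \<and> \<sigma> i = j})"
    using assms by auto (metis lessThan_iff permutes_def)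
  have "(\<Sum>\<sigma> | \<sigma> permutes {..<Suc n}. h \<sigma>) =
      (\<Sum>i<Suc n. \<Sum>\<sigma> | \<sigma> permutes {..<Suc n} \<and> \<sigma> i = j. h \<sigma>)"
    unfolding U
    by (rule sum.UNION_disjoint) (auto intro: finite_subset[OF _ finite_permutations] dest: permutes_inj injD)
  also have "\<dots> = (\<Sum>i<Suc n. \<Sum>\<rho> | \<rho> permutes {..<n}. h (permutation_insert i j \<rho>))"
    using permutation_fix[OF _ assms] permutation_insert_inj_on[OF _ assms]
    by (intro sum.cong[OF refl, of "{..<Suc n}"]) (simp add: sum.reindex atLeast0LessThan)
  finally show ?thesis .
qed

lemma image_insert_index: "i < Suc n \<Longrightarrow> insert_index i ` {..<n} = {..<Suc n} - {i}"
proof (intro equalityI subsetI)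
  fix x assume "x \<in> {..<Suc n} - {i}" "i < Suc n"
  then show "x \<in> insert_index i ` {..<n}"
    by (intro image_eqI[of _ _ "delete_index i x"]) (auto simp: insert_index_def delete_index_def)
qed (auto simp: insert_index_def split: if_splits)

text \<open>The element \<open>0\<close> can sit at each of the \<open>2 (N + 1)\<close> positions \<open>p\<close>, and all of them contribute
  equally; \<open>j + 1\<close> is the element paired with it.\<close>

lemma pfaffian_expand:
  fixes A :: "nat \<Rightarrow> nat \<Rightarrow> real"
  assumes skew: "\<And>i j. A i j = - A j i"
  shows "pfaffian (Suc N) A = (\<Sum>j<Suc (2 * N). (-1) ^ j * A 0 (Suc j) *
    pfaffian N (\<lambda>r s. A (Suc (insert_index j r)) (Suc (insert_index j s))))"
proof -
  let ?f = "\<lambda>N A \<sigma>. of_int (sign \<sigma>) * (\<Prod>i<N. A (\<sigma> (2 * i)) (\<sigma> (2 * i + 1)))"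
  let ?B = "\<lambda>j r s. A (Suc (insert_index j r)) (Suc (insert_index j s))"
  let ?c = "\<lambda>j. (-1) ^ j * A 0 (Suc j)"
  have half: "2 * (p div 2) < Suc (2 * N)" if "p < Suc (Suc (2 * N))" for p
  proof -
    have "p div 2 < Suc N" using that by auto
    then show ?thesis by simp
  qed
  \<comment> \<open>\<open>p\<close> is the position of \<open>0\<close>. Once it is deleted, the
    partner of \<open>0\<close> sits at \<open>2 * (p div 2)\<close>, whether \<open>p\<close> was
    the left or the right member of its pair, and its value \<open>Suc j\<close> has become
    \<open>j\<close>.\<close>
  have key: "?f (Suc N) A (permutation_insert p 0 (permutation_insert (2 * (p div 2)) j \<rho>)) =
      ?c j * ?f N (?B j) \<rho>"
    if p: "p < Suc (Suc (2 * N))" and j: "j < Suc (2 * N)" and \<rho>: "\<rho> permutes {..<2 * N}" for p j \<rho>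
  proof -
    define i where "i = p div 2"
    define \<pi> where "\<pi> = permutation_insert (2 * i) j \<rho>"
    define \<sigma> where "\<sigma> = permutation_insert p 0 \<pi>"
    have i: "i < Suc N" and i2: "2 * i < Suc (2 * N)" using p half[OF p] by (auto simp: i_def)
    have \<pi>: "\<pi> permutes {0..<Suc (2 * N)}"
      using permutation_fix[OF i2 j] \<rho> by (auto simp: \<pi>_def atLeast0LessThan)
    have "of_int (sign \<pi>) = (- 1 :: real) ^ j * of_int (sign \<rho>)"
      using signof_permutation_insert[OF _ i2 j, of \<rho>, where 'a = real] \<rho>
      by (simp add: \<pi>_def atLeast0LessThan power_add)
    moreover have "of_int (sign \<sigma>) = (- 1 :: real) ^ p * of_int (sign \<pi>)"
      using signof_permutation_insert[OF \<pi> p, of 0, where 'a = real] by (simp add: \<sigma>_def)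
    ultimately have sgn: "of_int (sign \<sigma>) = (- 1 :: real) ^ p * (-1) ^ j * of_int (sign \<rho>)" by simp
    \<comment> \<open>For odd \<open>p\<close> the pair is in reverse order, and the sign from
      skewness cancels \<open>(-1) ^ p\<close>.\<close>
    have pair: "(-1) ^ p * A (\<sigma> (2 * i)) (\<sigma> (2 * i + 1)) = A 0 (Suc j)"
    proof (cases "even p")
      case True
      then have "p = 2 * i" by (simp add: i_def)
      then show ?thesis by (simp add: \<sigma>_def \<pi>_def permutation_insert_expand)
    next
      case False
      then have "p = Suc (2 * i)" by (simp add: i_def)
      then show ?thesis using skew[of 0 "Suc j"] by (simp add: \<sigma>_def \<pi>_def permutation_insert_expand)
    qed
    have p': "2 * i \<le> p" "p \<le> Suc (2 * i)" by (auto simp: i_def)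
    have \<sigma>_ins: "\<sigma> (2 * insert_index i m) = Suc (insert_index j (\<rho> (2 * m)))"
      "\<sigma> (2 * insert_index i m + 1) = Suc (insert_index j (\<rho> (2 * m + 1)))" for m
      using p' unfolding \<sigma>_def \<pi>_def permutation_insert_expand insert_index_def
      by auto
    have "(\<Prod>m<Suc N. A (\<sigma> (2 * m)) (\<sigma> (2 * m + 1))) = A (\<sigma> (2 * i)) (\<sigma> (2 * i + 1)) *
        (\<Prod>m\<in>{..<Suc N} - {i}. A (\<sigma> (2 * m)) (\<sigma> (2 * m + 1)))"
      using i by (intro prod.remove) auto
    also have "(\<Prod>m\<in>{..<Suc N} - {i}. A (\<sigma> (2 * m)) (\<sigma> (2 * m + 1))) =
        (\<Prod>m<N. ?B j (\<rho> (2 * m)) (\<rho> (2 * m + 1)))"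
      unfolding image_insert_index[OF i, symmetric]
      by (subst prod.reindex[OF insert_index_inj_on]) (simp only: o_def \<sigma>_ins)
    finally have "?f (Suc N) A \<sigma> = ((-1) ^ p * A (\<sigma> (2 * i)) (\<sigma> (2 * i + 1))) * (-1) ^ j *
        ?f N (?B j) \<rho>"
      by (simp only: sgn mult_ac)
    then have "?f (Suc N) A \<sigma> = ?c j * ?f N (?B j) \<rho>"
      unfolding pair by (simp only: mult_ac)
    then show ?thesis unfolding \<sigma>_def \<pi>_def i_def .
  qed
  have "(\<Sum>\<sigma> | \<sigma> permutes {..<Suc (Suc (2 * N))}. ?f (Suc N) A \<sigma>) =
      (\<Sum>p<Suc (Suc (2 * N)). \<Sum>j<Suc (2 * N). \<Sum>\<rho> | \<rho> permutes {..<2 * N}.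
        ?f (Suc N) A (permutation_insert p 0 (permutation_insert (2 * (p div 2)) j \<rho>)))"
    using half by (subst sum_permutes_insert_position[of 0], simp, intro sum.cong refl
        sum_permutes_insert_value) auto
  also have "\<dots> = (\<Sum>p<Suc (Suc (2 * N)). \<Sum>j<Suc (2 * N). \<Sum>\<rho> | \<rho> permutes {..<2 * N}.
      ?c j * ?f N (?B j) \<rho>)"
    by (intro sum.cong refl key) auto
  also have "\<dots> = 2 * real (Suc N) * (\<Sum>j<Suc (2 * N). ?c j * (\<Sum>\<rho> | \<rho> permutes {..<2 * N}. ?f N (?B j) \<rho>))"
    by (simp add: sum_distrib_left del: sum.lessThan_Suc)
  finally have "pfaffian (Suc N) A = (2 * real (Suc N) * (\<Sum>j<Suc (2 * N). ?c j * (\<Sum>\<rho> | \<rho> permutes {..<2 * N}.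
      ?f N (?B j) \<rho>))) / (2 ^ Suc N * fact (Suc N))"
    by (simp add: pfaffian_def)
  \<comment> \<open>The \<open>2 * Suc N\<close> equal contributions reduce the normalisation
    \<open>2 ^ Suc N * fact (Suc N)\<close> to \<open>2 ^ N * fact N\<close>.\<close>
  also have "\<dots> = (\<Sum>j<Suc (2 * N). ?c j * (\<Sum>\<rho> | \<rho> permutes {..<2 * N}. ?f N (?B j) \<rho>)) / (2 ^ N * fact N)"
    by (simp add: divide_simps del: sum.lessThan_Suc of_nat_Suc)
  also have "\<dots> = (\<Sum>j<Suc (2 * N). ?c j * pfaffian N (?B j))"
    unfolding pfaffian_def by (subst sum_divide_distrib) simp
  finally show ?thesis .
qed

section \<open>Antisymmetry and expansion in Hirota's notation\<close>

lemma pfaffian_cong: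
  assumes "\<And>i j. i < 2 * N \<Longrightarrow> j < 2 * N \<Longrightarrow> A i j = B i j"
  shows "pfaffian N A = pfaffian N B"
proof -
  have "(\<Prod>i<N. A (\<sigma> (2 * i)) (\<sigma> (2 * i + 1))) = (\<Prod>i<N. B (\<sigma> (2 * i)) (\<sigma> (2 * i + 1)))"
    if "\<sigma> permutes {..<2 * N}" for \<sigma>
    using permutes_in_image[OF that] by (intro prod.cong refl assms) auto
  then show ?thesis by (simp add: pfaffian_def)
qed

lemma pfaffian_permute:
  assumes "\<tau> permutes {..<2 * N}"
  shows "pfaffian N (\<lambda>i j. A (\<tau> i) (\<tau> j)) = of_int (sign \<tau>) * pfaffian N A"
proof -
  have sgn: "of_int (sign (\<tau> \<circ> \<sigma>)) = (of_int (sign \<tau>) * of_int (sign \<sigma>) :: real)"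
    if "\<sigma> permutes {..<2 * N}" for \<sigma>
    using assms that permutation_permutes
    by (subst sign_compose) (auto intro!: permutation_permutes[THEN iffD2] exI[of _ "{..<2 * N}"])
  have sq: "of_int (sign \<tau>) * (of_int (sign \<tau>) * x) = x" for x :: real
    by (simp add: sign_def)
  show ?thesis
    unfolding pfaffian_def
    by (subst (2) setum_permutations_compose_left[OF assms])
      (simp add: sgn sum_distrib_left mult.assoc sq)
qed

lemma hirota_pf_Nil [simp]: "hirota_pf e [] = 1"
  by (simp add: hirota_pf_def pfaffian_def)

text \<open>Polymorphic, since it serves for entries of symbols, for their extension to formal sums
  and for the kernel \<open>\<omega>\<close> itself.\<close>

definition skew_entries :: "('s \<Rightarrow> 's \<Rightarrow> real) \<Rightarrow> bool" where
  "skew_entries e \<longleftrightarrow> (\<forall>a b. e a b = - e b a)"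

lemma skew_entriesD: "skew_entries e \<Longrightarrow> e a b = - e b a"
  unfolding skew_entries_def by blast

lemma hirota_pf_Cons:
  assumes skew: "skew_entries e" and "odd (length as)"
  shows "hirota_pf e (a # as) =
    (\<Sum>j<length as. (-1) ^ j * e a (as ! j) * hirota_pf e (take j as @ drop (Suc j) as))"
proof -
  obtain N where N: "length as = Suc (2 * N)"
    using assms(2) by (auto elim: oddE)
  have minor: "pfaffian N (\<lambda>r s. e (as ! insert_index j r) (as ! insert_index j s)) =
      hirota_pf e (take j as @ drop (Suc j) as)" if "j < length as" for j
  proof -
    have "(take j as @ drop (Suc j) as) ! r = as ! insert_index j r" if "r < 2 * N" for r
      using that \<open>j < length as\<close> N by (auto simp: nth_append insert_index_def)
    moreover have "length (take j as @ drop (Suc j) as) div 2 = N"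
      using that N by simp
    ultimately show ?thesis
      unfolding hirota_pf_def by (auto intro: pfaffian_cong)
  qed
  have "hirota_pf e (a # as) = (\<Sum>j<Suc (2 * N). (-1) ^ j * e a (as ! j) *
      pfaffian N (\<lambda>r s. e (as ! insert_index j r) (as ! insert_index j s)))"
    unfolding hirota_pf_def using N
    using pfaffian_expand[of "\<lambda>i j. e ((a # as) ! i) ((a # as) ! j)" N, OF skew_entriesD[OF skew]]
    by (simp del: sum.lessThan_Suc)
  also have "\<dots> = (\<Sum>j<length as. (-1) ^ j * e a (as ! j) * hirota_pf e (take j as @ drop (Suc j) as))"
    unfolding N[symmetric] by (intro sum.cong refl) (simp add: minor)
  finally show ?thesis .
qed

lemma hirota_pf_swap:
  assumes "even (length us + length vs)"
  shows "hirota_pf e (us @ a # b # vs) = - hirota_pf e (us @ b # a # vs)"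
proof -
  define N where "N = Suc ((length us + length vs) div 2)"
  define \<tau> where "\<tau> = Transposition.transpose (length us) (Suc (length us))"
  have N: "2 * N = length us + length vs + 2" using assms by (simp add: N_def)
  have \<tau>: "\<tau> permutes {..<2 * N}"
    unfolding \<tau>_def by (rule permutes_swap_id) (auto simp: N)
  have nth: "(us @ b # a # vs) ! \<tau> i = (us @ a # b # vs) ! i" for i
    by (auto simp: \<tau>_def Transposition.transpose_def nth_append nth_Cons split: nat.splits)
  have "hirota_pf e (us @ a # b # vs) =
      pfaffian N (\<lambda>i j. e ((us @ b # a # vs) ! \<tau> i) ((us @ b # a # vs) ! \<tau> j))"
    unfolding nth by (simp add: hirota_pf_def N_def)
  also have "\<dots> = - hirota_pf e (us @ b # a # vs)"
    by (subst pfaffian_permute[OF \<tau>, of "\<lambda>i j. e ((us @ b # a # vs) ! i) ((us @ b # a # vs) ! j)"])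
      (simp add: \<tau>_def sign_swap_id hirota_pf_def N_def)
  finally show ?thesis .
qed

text \<open>\<open>a\<close> passes \<open>us\<close> by \<open>length us\<close> adjacent swaps,
  each changing the sign.\<close>

lemma hirota_pf_move:
  assumes "odd (length us + length vs)"
  shows "hirota_pf e (us @ a # vs) = (-1) ^ length us * hirota_pf e (a # us @ vs)"
  using assms
proof (induction us arbitrary: vs rule: rev_induct)
  case (snoc x us)
  have "hirota_pf e ((us @ [x]) @ a # vs) = - hirota_pf e (us @ a # x # vs)"
    using hirota_pf_swap[of us vs e x a] snoc.prems by simp
  also have "hirota_pf e (us @ a # x # vs) = (-1) ^ length us * hirota_pf e (a # us @ x # vs)"
    using snoc.prems by (intro snoc.IH) simp
  finally show ?case by simp
qed simp

text \<open>Two equal symbols are moved to the front, where swapping them changes the sign but not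
  the list.\<close>

lemma hirota_pf_not_distinct:
  assumes "even (length as)" "\<not> distinct as"
  shows "hirota_pf e as = 0"
proof -
  obtain us vs ws a where as: "as = us @ [a] @ vs @ [a] @ ws"
    using not_distinct_decomp[OF assms(2)] by blast
  have odd: "odd (length us + length (vs @ a # ws))" "odd (length (a # us @ vs) + length ws)"
    and even: "even (length [] + length (us @ vs @ ws))"
    using assms(1) unfolding as length_append list.size by presburger+
  have "hirota_pf e as = (-1) ^ length us * hirota_pf e (a # us @ vs @ a # ws)"
    using hirota_pf_move[OF odd(1), of e a] by (simp only: as append_Cons append_Nil)
  also have "hirota_pf e (a # us @ vs @ a # ws) =
      (-1) ^ length (a # us @ vs) * hirota_pf e (a # a # us @ vs @ ws)"
    using hirota_pf_move[OF odd(2), of e a] by (simp only: append_Cons append_assoc)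
  also have "hirota_pf e (a # a # us @ vs @ ws) = 0"
    using hirota_pf_swap[OF even, of e a a] by simp
  finally show ?thesis by simp
qed

text \<open>Both sides are the same double sum, once the second factor on the left and the first factor on
  the right are expanded. If \<open>as\<close> and \<open>bs\<close> share most symbols, most summands vanish.\<close>

lemma hirota_pf_exchange:
  assumes skew: "skew_entries e" and "odd (length as)" "odd (length bs)"
  shows "(\<Sum>i<length as. (-1) ^ i * hirota_pf e (take i as @ drop (Suc i) as) * hirota_pf e (as ! i # bs)) =
    - (\<Sum>j<length bs. (-1) ^ j * hirota_pf e (bs ! j # as) * hirota_pf e (take j bs @ drop (Suc j) bs))"
proof -
  let ?A = "\<lambda>i. (-1) ^ i * hirota_pf e (take i as @ drop (Suc i) as)"
  let ?B = "\<lambda>j. (-1) ^ j * hirota_pf e (take j bs @ drop (Suc j) bs)"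
  have flip: "e (as ! i) (bs ! j) * ?A i * ?B j = - (e (bs ! j) (as ! i) * ?A i * ?B j)" for i j
    using skew_entriesD[OF skew, of "as ! i" "bs ! j"] by simp
  have "(\<Sum>i<length as. (-1) ^ i * hirota_pf e (take i as @ drop (Suc i) as) * hirota_pf e (as ! i # bs)) =
      (\<Sum>i<length as. \<Sum>j<length bs. e (as ! i) (bs ! j) * ?A i * ?B j)"
    by (simp add: hirota_pf_Cons[OF skew assms(3)] sum_distrib_left mult_ac)
  also have "\<dots> = (\<Sum>j<length bs. \<Sum>i<length as. - (e (bs ! j) (as ! i) * ?A i * ?B j))"
    by (subst sum.swap) (simp only: flip)
  also have "\<dots> = - (\<Sum>j<length bs. (-1) ^ j * hirota_pf e (bs ! j # as) *
      hirota_pf e (take j bs @ drop (Suc j) bs))"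
    by (simp add: hirota_pf_Cons[OF skew assms(2)] sum_distrib_left sum_distrib_right sum_negf mult_ac)
  finally show ?thesis .
qed

section \<open>Four-term Pluecker relations\<close>

text \<open>In the exchange identity for \<open>a # xs\<close> and \<open>b # c # d # xs\<close>, a
  summand that moves a symbol of \<open>xs\<close> vanishes, as that symbol then occurs twice.
  Moving \<open>a\<close> gives the left side, moving \<open>b\<close>, \<open>c\<close>,
  \<open>d\<close> the three products on the right.\<close>

lemma hirota_pf_pluecker_even:
  assumes skew: "skew_entries e" and "even (length xs)"
  shows "hirota_pf e xs * hirota_pf e (a # b # c # d # xs) =
    hirota_pf e (a # b # xs) * hirota_pf e (c # d # xs)
    - hirota_pf e (a # c # xs) * hirota_pf e (b # d # xs)
    + hirota_pf e (a # d # xs) * hirota_pf e (b # c # xs)"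
proof -
  have "hirota_pf e (xs ! i # b # c # d # xs) = 0" "hirota_pf e (xs ! i # a # xs) = 0"
    if "i < length xs" for i
    using assms(2) that by (auto intro!: hirota_pf_not_distinct)
  moreover have "hirota_pf e (b # a # xs) = - hirota_pf e (a # b # xs)"
    "hirota_pf e (c # a # xs) = - hirota_pf e (a # c # xs)"
    "hirota_pf e (d # a # xs) = - hirota_pf e (a # d # xs)"
    using hirota_pf_swap[of "[]" xs e _ a] assms(2) by simp_all
  ultimately show ?thesis
    using hirota_pf_exchange[OF skew, of "a # xs" "b # c # d # xs"] assms(2)
    by (simp add: sum.lessThan_Suc_shift del: sum.lessThan_Suc)
qed

text \<open>In the exchange identity for \<open>xs\<close> and \<open>a # b # c # d # xs\<close> the
  whole left side vanishes by repetition, and on the right only the moves of \<open>a\<close>,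
  \<open>b\<close>, \<open>c\<close>, \<open>d\<close> survive.\<close>

lemma hirota_pf_pluecker_odd:
  assumes skew: "skew_entries e" and "odd (length xs)"
  shows "hirota_pf e (a # xs) * hirota_pf e (b # c # d # xs)
    - hirota_pf e (b # xs) * hirota_pf e (a # c # d # xs)
    + hirota_pf e (c # xs) * hirota_pf e (a # b # d # xs)
    - hirota_pf e (d # xs) * hirota_pf e (a # b # c # xs) = 0"
proof -
  have "hirota_pf e (xs ! i # a # b # c # d # xs) = 0" "hirota_pf e (xs ! i # xs) = 0"
    if "i < length xs" for i
    using assms(2) that by (auto intro!: hirota_pf_not_distinct)
  then show ?thesis
    using hirota_pf_exchange[OF skew, of "xs" "a # b # c # d # xs"] assms(2)
    by (simp add: sum.lessThan_Suc_shift del: sum.lessThan_Suc)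
qed

lemma hirota_pf_cong:
  assumes "\<And>a b. a \<in> set as \<Longrightarrow> b \<in> set as \<Longrightarrow> e a b = e' (f a) (f b)"
  shows "hirota_pf e as = hirota_pf e' (map f as)"
  unfolding hirota_pf_def length_map
  using assms by (intro pfaffian_cong) auto

section \<open>Formal sums of symbols\<close>

text \<open>A list \<open>[a, b, \<dots>]\<close> of symbols stands for the formal sum \<open>a + b + \<dots>\<close>, to which the entries
  extend bilinearly.\<close>

definition formal_sum_entry :: "('s \<Rightarrow> 's \<Rightarrow> real) \<Rightarrow> 's list \<Rightarrow> 's list \<Rightarrow> real" where
  "formal_sum_entry e us vs = (\<Sum>a\<leftarrow>us. \<Sum>b\<leftarrow>vs. e a b)"

lemma formal_sum_entry_single [simp]: "formal_sum_entry e [a] [b] = e a b"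
  by (simp add: formal_sum_entry_def)

lemma formal_sum_entry_append:
  "formal_sum_entry e (us @ us') vs = formal_sum_entry e us vs + formal_sum_entry e us' vs"
  by (simp add: formal_sum_entry_def)

lemma skew_formal_sum_entry:
  assumes "skew_entries e"
  shows "skew_entries (formal_sum_entry e)"
proof -
  have "(\<Sum>a\<leftarrow>us. \<Sum>b\<leftarrow>vs. e a b) = - (\<Sum>b\<leftarrow>vs. \<Sum>a\<leftarrow>us. e b a)" for us vs
  proof (induction us)
    case (Cons a us)
    have "(\<Sum>b\<leftarrow>vs. e a b) = - (\<Sum>b\<leftarrow>vs. e b a)"
      by (induction vs) (simp_all, subst skew_entriesD[OF assms], simp)
    with Cons show ?case by (simp add: sum_list_addf)
  qed simp
  then show ?thesis unfolding skew_entries_def formal_sum_entry_def by blast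
qed

text \<open>With the sum moved to the front, this is linearity of the entries in the expansion along
  it.\<close>

lemma hirota_pf_formal_sum_append:
  assumes skew: "skew_entries e" and len: "odd (length us + length vs)"
  shows "hirota_pf (formal_sum_entry e) (us @ (a @ b) # vs) =
    hirota_pf (formal_sum_entry e) (us @ a # vs) + hirota_pf (formal_sum_entry e) (us @ b # vs)"
proof -
  note exp = hirota_pf_Cons[OF skew_formal_sum_entry[OF skew], of "us @ vs"]
  have "hirota_pf (formal_sum_entry e) ((a @ b) # us @ vs) =
      hirota_pf (formal_sum_entry e) (a # us @ vs) + hirota_pf (formal_sum_entry e) (b # us @ vs)"
    using len by (simp add: exp formal_sum_entry_append algebra_simps sum.distrib)
  then show ?thesis by (simp add: hirota_pf_move[OF len] algebra_simps)
qed

text \<open>Column operations: adding \<open>x\<^sub>i\<close> to \<open>x\<^sub>i\<^sub>+\<^sub>1\<close> does not change the Pfaffian.\<close>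

lemma hirota_pf_telescope:
  assumes skew: "skew_entries e" and "even (length us + Suc m + length vs)"
  shows "hirota_pf (formal_sum_entry e) (us @ map (\<lambda>i. [x i]) [0..<Suc m] @ vs) =
    hirota_pf (formal_sum_entry e) (us @ [x 0] # map (\<lambda>i. [x i, x (Suc i)]) [0..<m] @ vs)"
  using assms(2)
proof (induction m arbitrary: vs)
  case (Suc m)
  let ?pf = "hirota_pf (formal_sum_entry e)"
  let ?us = "us @ [x 0] # map (\<lambda>i. [x i, x (Suc i)]) [0..<m]"
  have IH: "?pf (us @ map (\<lambda>i. [x i]) [0..<Suc m] @ v # vs) = ?pf (?us @ v # vs)" for v
    using Suc.IH[of "v # vs"] Suc.prems by simp
  \<comment> \<open>Undoing the column operations by \<open>IH\<close> yields a list that contains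
    \<open>[x m]\<close> twice.\<close>
  have "?pf (?us @ [x m] # vs) = 0"
    unfolding IH[symmetric] using Suc.prems by (intro hirota_pf_not_distinct) auto
  moreover have "?pf (?us @ ([x m] @ [x (Suc m)]) # vs) =
      ?pf (?us @ [x m] # vs) + ?pf (?us @ [x (Suc m)] # vs)"
    using Suc.prems by (intro hirota_pf_formal_sum_append[OF skew]) simp
  ultimately show ?case
    using IH[of "[x (Suc m)]"] by simp
qed simp

lemma hirota_pf_Cons_single:
  assumes skew: "skew_entries e" and "even (length as)" and "\<And>b. b \<in> set as \<Longrightarrow> e a b = 0"
  shows "hirota_pf e (a # b # as) = e a b * hirota_pf e as"
proof -
  have "e a (as ! i) = 0" if "i < length as" for i
    using that assms(3) by simp
  then show ?thesis
    using assms(2) by (simp add: hirota_pf_Cons[OF skew] sum.lessThan_Suc_shift del: sum.lessThan_Suc)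
qed

text \<open>The entries of \<open>c\<close> annihilate the sums of consecutive symbols, so only \<open>x\<^sub>0\<close> contributes to
  the expansion along \<open>c\<close>.\<close>

lemma hirota_pf_consecutive_sums:
  assumes skew: "skew_entries e" and len: "even (length us + m + length vs)"
    and c: "\<And>b. b \<in> set us \<union> set vs \<Longrightarrow> e c b = 0"
      "\<And>i. i < m \<Longrightarrow> e c (x i) + e c (x (Suc i)) = 0"
  shows "hirota_pf e (c # us @ map x [0..<Suc m] @ vs) = (-1) ^ length us * e c (x 0) *
    hirota_pf (formal_sum_entry e)
      (map (\<lambda>a. [a]) us @ map (\<lambda>i. [x i, x (Suc i)]) [0..<m] @ map (\<lambda>a. [a]) vs)"
proof -
  let ?pf = "hirota_pf (formal_sum_entry e)"
  let ?us = "map (\<lambda>a. [a]) us" and ?vs = "map (\<lambda>a. [a]) vs"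
  let ?ys = "map (\<lambda>i. [x i, x (Suc i)]) [0..<m]"
  have odd: "odd (length ([c] # ?us) + length (?ys @ ?vs))"
    and even: "even (length (?us @ ?ys @ ?vs))"
    using len by (simp_all add: add.assoc)
  have "hirota_pf e (c # us @ map x [0..<Suc m] @ vs) =
      ?pf (([c] # ?us) @ map (\<lambda>i. [x i]) [0..<Suc m] @ ?vs)"
    by (subst hirota_pf_cong[where f = "\<lambda>a. [a]" and e' = "formal_sum_entry e"])
      (simp_all del: upt_Suc add: o_def)
  also have "\<dots> = ?pf (([c] # ?us) @ [x 0] # ?ys @ ?vs)"
    using len by (intro hirota_pf_telescope[OF skew]) simp
  \<comment> \<open>\<open>[x 0]\<close> passes \<open>[c]\<close> and \<open>?us\<close>, which
    costs \<open>length us + 1\<close> signs; the swap with \<open>[c]\<close> afterwards removes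
    one.\<close>
  also have "\<dots> = - ((-1) ^ length us) * ?pf ([x 0] # [c] # ?us @ ?ys @ ?vs)"
    using hirota_pf_move[OF odd, of "formal_sum_entry e" "[x 0]"] by simp
  also have "?pf ([x 0] # [c] # ?us @ ?ys @ ?vs) = - ?pf ([c] # [x 0] # ?us @ ?ys @ ?vs)"
    using hirota_pf_swap[of "[]" "?us @ ?ys @ ?vs" "formal_sum_entry e" "[x 0]" "[c]"] even by simp
  also have "?pf ([c] # [x 0] # ?us @ ?ys @ ?vs) = e c (x 0) * ?pf (?us @ ?ys @ ?vs)"
  proof (subst hirota_pf_Cons_single[OF skew_formal_sum_entry[OF skew]])
    show "even (length (?us @ ?ys @ ?vs))" by (rule even)
    show "formal_sum_entry e [c] b = 0" if "b \<in> set (?us @ ?ys @ ?vs)" for b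
      using that c by (auto simp: formal_sum_entry_def)
  qed simp
  finally show ?thesis by simp
qed

text \<open>The minors of the two expansions coincide, so proportional first rows suffice. The
  factors stay on both sides to avoid division: the use has \<open>r = z + 1\<close>, which may be
  zero.\<close>

lemma hirota_pf_Cons_scale:
  assumes skew: "skew_entries e" "skew_entries e'" and len: "odd (length as)"
    and f: "\<And>a b. a \<in> set as \<Longrightarrow> b \<in> set as \<Longrightarrow> e a b = e' (f a) (f b)"
    and c: "\<And>a. a \<in> set as \<Longrightarrow> r * e c a = s * e' c' (f a)"
  shows "r * hirota_pf e (c # as) = s * hirota_pf e' (c' # map f as)"
proof -
  let ?pf = "\<lambda>j. hirota_pf e (take j as @ drop (Suc j) as)"
  let ?pf' = "\<lambda>j. hirota_pf e' (take j (map f as) @ drop (Suc j) (map f as))"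
  have pf: "?pf j = ?pf' j" for j
    using f by (subst hirota_pf_cong[where e' = e' and f = f])
      (auto simp: take_map drop_map dest: in_set_takeD in_set_dropD)
  have summand: "r * ((-1) ^ j * e c (as ! j) * ?pf j) = s * ((-1) ^ j * e' c' (map f as ! j) * ?pf' j)"
    if "j < length as" for j
  proof -
    have "r * ((-1) ^ j * e c (as ! j) * ?pf j) = (-1) ^ j * (r * e c (as ! j)) * ?pf j"
      by simp
    also have "\<dots> = (-1) ^ j * (s * e' c' (map f as ! j)) * ?pf' j"
      using that c by (simp only: pf nth_map nth_mem)
    finally show ?thesis by simp
  qed
  have "r * hirota_pf e (c # as) = (\<Sum>j<length as. r * ((-1) ^ j * e c (as ! j) * ?pf j))"
    by (simp only: hirota_pf_Cons[OF skew(1) len] sum_distrib_left)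
  also have "\<dots> = (\<Sum>j<length as. s * ((-1) ^ j * e' c' (map f as ! j) * ?pf' j))"
    by (intro sum.cong refl summand) simp
  also have "\<dots> = s * hirota_pf e' (c' # map f as)"
    by (subst hirota_pf_Cons[OF skew(2)]) (use len in simp, simp only: sum_distrib_left length_map)
  finally show ?thesis .
qed

section \<open>Pluecker relations with symbols at both ends\<close>

lemma hirota_pf_append1:
  assumes "odd (length us)"
  shows "hirota_pf e (us @ [s]) = - hirota_pf e (s # us)"
  using hirota_pf_move[of us "[]" e s] assms by simp

lemma hirota_pf_append2:
  assumes "even (length us)"
  shows "hirota_pf e (us @ [s, t]) = hirota_pf e (s # t # us)"
  using hirota_pf_move[of us "[t]" e s] hirota_pf_append1[of "s # us" e t]
    hirota_pf_swap[of "[]" us e t s] assms by simp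

text \<open>The four-term relation for \<open>s\<close>, \<open>t\<close>, \<open>c\<close>,
  \<open>d\<close>, with \<open>s\<close> and \<open>t\<close> moved to the end, where
  \<open>hirota_pf_recurrence\<close> has \<open>n + 1\<close> and \<open>z\<close>.\<close>

lemma hirota_pf_bilinear_even:
  assumes skew: "skew_entries e" and "even (length xs)"
  shows "hirota_pf e (c # d # xs) * hirota_pf e (xs @ [s, t]) =
    hirota_pf e xs * hirota_pf e (c # d # xs @ [s, t])
    + hirota_pf e (c # xs @ [s]) * hirota_pf e (d # xs @ [t])
    - hirota_pf e (d # xs @ [s]) * hirota_pf e (c # xs @ [t])"
  using hirota_pf_pluecker_even[OF assms, of s t c d] assms(2)
    hirota_pf_append2[of xs e s t] hirota_pf_append2[of "c # d # xs" e s t]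
    hirota_pf_append1[of "c # xs" e] hirota_pf_append1[of "d # xs" e]
  by simp

lemma hirota_pf_bilinear_odd:
  assumes skew: "skew_entries e" and "odd (length xs)"
  shows "hirota_pf e (c # xs) * hirota_pf e (d # xs @ [s, t]) =
    hirota_pf e (d # xs) * hirota_pf e (c # xs @ [s, t])
    + hirota_pf e (c # d # xs @ [s]) * hirota_pf e (xs @ [t])
    - hirota_pf e (xs @ [s]) * hirota_pf e (c # d # xs @ [t])"
  using hirota_pf_pluecker_odd[OF assms, of s t c d] assms(2)
    hirota_pf_append2[of "c # xs" e s t] hirota_pf_append2[of "d # xs" e s t]
    hirota_pf_append1[of "c # d # xs" e] hirota_pf_append1[of xs e]
  by (simp add: algebra_simps)

section \<open>Change of superscripts\<close>

definition idx :: "nat \<Rightarrow> symbol list" where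
  "idx m = map (\<lambda>i. Idx (int i)) [0..<m]"

definition d0_if_odd :: "nat \<Rightarrow> symbol list" where
  "d0_if_odd n = (if even n then [] else [D0])"

lemma length_idx [simp]: "length (idx m) = m"
  by (simp add: idx_def)

lemma idx_Suc: "idx (Suc m) = idx m @ [Idx (int m)]"
  by (simp add: idx_def)

lemma d0_if_odd_Suc_Suc [simp]: "d0_if_odd (Suc (Suc n)) = d0_if_odd n"
  by (simp add: d0_if_odd_def)

lemma minus_one_power_length_d0 [simp]: "(-1) ^ length (d0_if_odd n) = ((-1) ^ n :: real)"
  by (simp add: d0_if_odd_def)

lemma even_length_d0 [simp]: "even (length (d0_if_odd n)) \<longleftrightarrow> even n"
  by (simp add: d0_if_odd_def)

lemma symbols_int: "symbols (int n) (int m - 1) = d0_if_odd n @ idx m"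
proof -
  have "[0..int m - 1] = map int [0..<m]"
    by (intro nth_equalityI) auto
  then show ?thesis by (simp add: symbols_def d0_if_odd_def idx_def o_def)
qed

lemma tau_int: "tau \<omega> \<rho> (int n) k l = hirota_pf (entry \<omega> \<rho> k l) (d0_if_odd n @ idx n)"
  by (simp add: tau_def symbols_int)

lemma P_val_int:
  "P_val \<omega> \<rho> (int n) k l z = z ^ n / tau \<omega> \<rho> (int n) k l *
    hirota_pf (entry \<omega> \<rho> k l) (d0_if_odd n @ idx (Suc n) @ [Zsym z])"
  using symbols_int[of n "Suc n"] by (simp add: P_val_def)

text \<open>The common part is \<open>idx (Suc n)\<close>, of length \<open>n + 1\<close>. Each
  product contains \<open>c\<close>, \<open>D0\<close>, \<open>Idx (n + 1)\<close> and
  \<open>t\<close> once; the parity of \<open>n\<close> decides which factor holds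
  \<open>D0\<close>, so both Pluecker relations take this one form.\<close>

lemma hirota_pf_recurrence:
  assumes skew: "skew_entries e"
  shows "hirota_pf e (c # d0_if_odd n @ idx (Suc n)) *
      hirota_pf e (d0_if_odd (Suc n) @ idx (Suc (Suc n)) @ [t]) =
    hirota_pf e (d0_if_odd (Suc n) @ idx (Suc n)) *
      hirota_pf e (c # d0_if_odd n @ idx (Suc (Suc n)) @ [t])
    + hirota_pf e (c # d0_if_odd (Suc n) @ idx (Suc (Suc n))) *
      hirota_pf e (d0_if_odd n @ idx (Suc n) @ [t])
    - hirota_pf e (d0_if_odd n @ idx (Suc (Suc n))) *
      hirota_pf e (c # d0_if_odd (Suc n) @ idx (Suc n) @ [t])"
proof (cases "even n")
  case True
  then show ?thesis
    using hirota_pf_bilinear_odd[OF skew, of "idx (Suc n)" c D0 "Idx (int (Suc n))" t]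
    by (simp add: d0_if_odd_def idx_Suc[of "Suc n"])
next
  case False
  then show ?thesis
    using hirota_pf_bilinear_even[OF skew, of "idx (Suc n)" c D0 "Idx (int (Suc n))" t]
    by (simp add: d0_if_odd_def idx_Suc[of "Suc n"])
qed

section \<open>Moments: skew symmetry and shift of superscripts\<close>

text \<open>Swap invariance holds for the product measure \<open>lborel\<close> and passes to its
  completion, first in the source and then in the target.\<close>

lemma distr_lebesgue_swap:
  "distr lebesgue lebesgue (\<lambda>(x, y). (y, x)) = (lebesgue :: (real \<times> real) measure)"
    (is "distr _ _ ?s = _")
  and measurable_lebesgue_swap:
  "(\<lambda>(x, y). (y, x)) \<in> lebesgue \<rightarrow>\<^sub>M (lebesgue :: (real \<times> real) measure)"
proof -
  have m: "?s \<in> lborel \<rightarrow>\<^sub>M (lborel :: (real \<times> real) measure)"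
    unfolding lborel_prod[symmetric] by (rule measurable_pair_swap')
  have m': "?s \<in> lebesgue \<rightarrow>\<^sub>M (lborel :: (real \<times> real) measure)"
    using m by (rule measurable_completion)
  have d: "distr lborel lborel ?s = (lborel :: (real \<times> real) measure)"
    unfolding lborel_prod[symmetric] by (rule lborel_pair.distr_pair_swap[symmetric])
  have d': "distr lebesgue lborel ?s = (lborel :: (real \<times> real) measure)"
    using m d by (simp add: distr_completion)
  show "distr lebesgue lebesgue ?s = (lebesgue :: (real \<times> real) measure)"
    using completion.completion_distr_eq[OF m'] d' by simp
  show "?s \<in> lebesgue \<rightarrow>\<^sub>M (lebesgue :: (real \<times> real) measure)"
    using completion.measurable_completion2[OF m'] d' by simp
qed

lemma mu_skew:
  assumes skew: "skew_entries \<omega>"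
    and conv: "integrable lebesgue (mu_integrand \<omega> \<rho> j i k l)"
  shows "mu \<omega> \<rho> i j k l = - mu \<omega> \<rho> j i k l"
proof -
  have flip: "mu_integrand \<omega> \<rho> i j k l = (\<lambda>p. - mu_integrand \<omega> \<rho> j i k l (case p of (x, y) \<Rightarrow> (y, x)))"
  proof
    fix p :: "real \<times> real"
    obtain x y where "p = (x, y)" by (cases p)
    then show "mu_integrand \<omega> \<rho> i j k l p = - mu_integrand \<omega> \<rho> j i k l (case p of (x, y) \<Rightarrow> (y, x))"
      by (simp add: mu_integrand_def skew_entriesD[OF skew, of x y] mult_ac)
  qed
  have "mu \<omega> \<rho> j i k l = integral\<^sup>L (distr lebesgue lebesgue (\<lambda>(x, y). (y, x))) (mu_integrand \<omega> \<rho> j i k l)"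
    by (simp add: mu_def distr_lebesgue_swap)
  also have "\<dots> = (LINT p|lebesgue. mu_integrand \<omega> \<rho> j i k l (case p of (x, y) \<Rightarrow> (y, x)))"
    using conv by (intro integral_distr measurable_lebesgue_swap) simp
  finally show ?thesis
    unfolding mu_def by (subst flip) simp
qed

lemma power_int_shift:
  fixes x :: real
  assumes "x \<noteq> 0"
  shows "x powi (k - 1 - i) * (1 + x) ^ Suc l = (x powi (k - i) + x powi (k - (i + 1))) * (1 + x) ^ l"
proof -
  have "x powi (k - i) = x powi (k - 1 - i) * x"
    using power_int_add_1[of x "k - 1 - i"] assms by (simp add: algebra_simps)
  then show ?thesis by (simp add: algebra_simps)
qed

lemma beta_shift:
  assumes conv: "\<And>i k l. integrable lebesgue (beta_integrand \<rho> i k l)"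
  shows "beta \<rho> i (k - 1) (Suc l) = beta \<rho> i k l + beta \<rho> (i + 1) k l"
proof -
  \<comment> \<open>The integrands are compared off \<open>x = 0\<close>: there negative powers are
    \<open>0\<close> and \<open>power_int_shift\<close> fails for \<open>i = k\<close>.\<close>
  have "{0::real} \<in> null_sets lebesgue" by simp
  then have "AE x::real in lebesgue. x \<noteq> 0"
    by (rule AE_I') auto
  then have "AE x in lebesgue. beta_integrand \<rho> i (k - 1) (Suc l) x =
      beta_integrand \<rho> i k l x + beta_integrand \<rho> (i + 1) k l x"
  proof eventually_elim
    case (elim x)
    then show ?case
      using power_int_shift[of x k i l] by (simp add: beta_integrand_def algebra_simps)
  qed
  then have "beta \<rho> i (k - 1) (Suc l) =
      (LINT x|lebesgue. beta_integrand \<rho> i k l x + beta_integrand \<rho> (i + 1) k l x)"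
    unfolding beta_def by (intro integral_cong_AE) (use conv in auto)
  also have "\<dots> = beta \<rho> i k l + beta \<rho> (i + 1) k l"
    unfolding beta_def by (rule Bochner_Integration.integral_add[OF conv conv])
  finally show ?thesis .
qed

text \<open>The shift is applied in both variables; the terms are bracketed as in the double sum
  \<open>formal_sum_entry\<close>.\<close>

lemma mu_shift:
  assumes conv: "\<And>i j k l. integrable lebesgue (mu_integrand \<omega> \<rho> i j k l)"
  shows "mu \<omega> \<rho> i j (k - 1) (Suc l) =
    mu \<omega> \<rho> i j k l + mu \<omega> \<rho> i (j + 1) k l + (mu \<omega> \<rho> (i + 1) j k l + mu \<omega> \<rho> (i + 1) (j + 1) k l)"
proof -
  let ?f = "\<lambda>i j. mu_integrand \<omega> \<rho> i j k l"
  \<comment> \<open>Both coordinate axes are hyperplanes, hence null sets.\<close>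
  have "negligible {p :: real \<times> real. (1, 0) \<bullet> p = 0}" "negligible {p :: real \<times> real. (0, 1) \<bullet> p = 0}"
    by (rule negligible_hyperplane; simp add: zero_prod_def)+
  then have "{p :: real \<times> real. fst p = 0} \<in> null_sets lebesgue" "{p :: real \<times> real. snd p = 0} \<in> null_sets lebesgue"
    by (simp_all add: negligible_iff_null_sets inner_prod_def)
  then have "AE p::real \<times> real in lebesgue. fst p \<noteq> 0" "AE p::real \<times> real in lebesgue. snd p \<noteq> 0"
    by (auto elim: AE_I')
  then have "AE p in lebesgue. mu_integrand \<omega> \<rho> i j (k - 1) (Suc l) p =
      ?f i j p + ?f i (j + 1) p + (?f (i + 1) j p + ?f (i + 1) (j + 1) p)"
  proof eventually_elim
    case (elim p)
    obtain x y where p: "p = (x, y)" by (cases p)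
    with elim have nz: "x \<noteq> 0" "y \<noteq> 0" by simp_all
    have "mu_integrand \<omega> \<rho> i j (k - 1) (Suc l) p =
        (x powi (k - 1 - i) * (1 + x) ^ Suc l) * (y powi (k - 1 - j) * (1 + y) ^ Suc l) * (\<omega> x y * \<rho> x * \<rho> y)"
      by (simp only: mu_integrand_def p prod.case mult_ac)
    also have "\<dots> = (x powi (k - i) + x powi (k - (i + 1))) * (1 + x) ^ l *
        ((y powi (k - j) + y powi (k - (j + 1))) * (1 + y) ^ l) * (\<omega> x y * \<rho> x * \<rho> y)"
      unfolding power_int_shift[OF nz(1)] power_int_shift[OF nz(2)] ..
    also have "\<dots> = ?f i j p + ?f i (j + 1) p + (?f (i + 1) j p + ?f (i + 1) (j + 1) p)"
      unfolding mu_integrand_def p prod.case by (simp only: algebra_simps)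
    finally show ?case .
  qed
  then have "mu \<omega> \<rho> i j (k - 1) (Suc l) =
      (LINT p|lebesgue. ?f i j p + ?f i (j + 1) p + (?f (i + 1) j p + ?f (i + 1) (j + 1) p))"
    unfolding mu_def by (intro integral_cong_AE) (use conv in auto)
  also have "\<dots> = mu \<omega> \<rho> i j k l + mu \<omega> \<rho> i (j + 1) k l +
      (mu \<omega> \<rho> (i + 1) j k l + mu \<omega> \<rho> (i + 1) (j + 1) k l)"
    unfolding mu_def by (simp add: conv)
  finally show ?thesis .
qed

lemma skew_entries_entry:
  assumes "skew_entries \<omega>"
    and "\<And>i j k l. integrable lebesgue (mu_integrand \<omega> \<rho> i j k l)"
  shows "skew_entries (entry \<omega> \<rho> k l)"
  unfolding skew_entries_def
proof (intro allI)
  fix a b show "entry \<omega> \<rho> k l a b = - entry \<omega> \<rho> k l b a"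
    by (cases a; cases b) (auto intro: mu_skew[OF assms])
qed

section \<open>Pfaffians with shifted superscripts\<close>

fun shift_symbol :: "symbol \<Rightarrow> symbol list" where
  "shift_symbol (Idx i) = [Idx i, Idx (i + 1)]"
| "shift_symbol a = [a]"

lemma entry_shift:
  assumes "\<And>i j k l. integrable lebesgue (mu_integrand \<omega> \<rho> i j k l)"
    and "\<And>i k l. integrable lebesgue (beta_integrand \<rho> i k l)"
    and "a \<notin> range Zsym" "b \<notin> range Zsym"
  shows "entry \<omega> \<rho> (k - 1) (Suc l) a b =
    formal_sum_entry (entry \<omega> \<rho> k l) (shift_symbol a) (shift_symbol b)"
  using assms(3,4) mu_shift[OF assms(1)] beta_shift[OF assms(2)]
  by (cases a; cases b) (auto simp: formal_sum_entry_def)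

text \<open>\<open>z * (z powi (- i) + z powi (- (i + 1))) = (z + 1) * z powi (- i)\<close>. Thus
  \<open>Zsym z\<close> follows the shift only up to these factors, the source of
  \<open>z + 1\<close> in the recurrence.\<close>

lemma entry_shift_Zsym:
  assumes "z \<noteq> 0" "a \<notin> range Zsym"
  shows "(z + 1) * entry \<omega> \<rho> (k - 1) (Suc l) (Zsym z) a =
    z * formal_sum_entry (entry \<omega> \<rho> k l) [Zsym z] (shift_symbol a)"
proof (cases a)
  case (Idx i)
  have "z powi (- i) = z powi (- (i + 1)) * z"
    using power_int_add_1[of z "- (i + 1)"] assms(1) by simp
  then show ?thesis
    unfolding Idx shift_symbol.simps formal_sum_entry_def entry.simps list.map sum_list.Cons sum_list.Nil
    by (simp only: algebra_simps)
qed (use assms in \<open>auto simp: formal_sum_entry_def\<close>)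

lemma map_shift_symbol:
  "map shift_symbol (d0_if_odd n @ idx m) =
    map (\<lambda>a. [a]) (d0_if_odd n) @ map (\<lambda>i. [Idx (int i), Idx (int (Suc i))]) [0..<m]"
  by (simp add: d0_if_odd_def idx_def o_def add.commute)

lemma symbols_not_Zsym: "a \<in> set (d0_if_odd n @ idx m) \<Longrightarrow> a \<notin> range Zsym"
  by (auto simp: d0_if_odd_def idx_def split: if_splits)

text \<open>The symbol \<open>Zsym (- 1)\<close> plays the role of \<open>c\<close>.\<close>

lemma hirota_pf_shift_symbol:
  assumes skew: "skew_entries (entry \<omega> \<rho> k l)" and len: "even (length (d0_if_odd n) + m + length vs)"
    and vs: "set vs \<subseteq> range Zsym"
  shows "hirota_pf (formal_sum_entry (entry \<omega> \<rho> k l))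
      (map shift_symbol (d0_if_odd n @ idx m) @ map (\<lambda>a. [a]) vs) =
    - ((-1) ^ n * hirota_pf (entry \<omega> \<rho> k l) (Zsym (- 1) # d0_if_odd n @ idx (Suc m) @ vs))"
proof -
  let ?e = "entry \<omega> \<rho> k l"
  have "(- 1 :: real) powi (- int i) = (- 1) ^ i" for i
    by (cases "even i") (simp_all add: power_int_minus)
  then have "?e (Zsym (- 1)) (Idx (int i)) + ?e (Zsym (- 1)) (Idx (int (Suc i))) = 0" for i
    unfolding entry.simps by (simp only: power_Suc)
  \<comment> \<open>The last clause of \<open>entry\<close> makes \<open>Zsym\<close> orthogonal to
    \<open>D0\<close> and to every \<open>Zsym\<close>.\<close>
  moreover have "?e (Zsym (- 1)) b = 0" if "b \<in> set (d0_if_odd n) \<union> set vs" for b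
    using that vs by (auto simp: d0_if_odd_def split: if_splits)
  ultimately have "hirota_pf ?e (Zsym (- 1) # d0_if_odd n @ map (\<lambda>i. Idx (int i)) [0..<Suc m] @ vs) =
      (-1) ^ length (d0_if_odd n) * ?e (Zsym (- 1)) (Idx (int 0)) *
      hirota_pf (formal_sum_entry ?e) (map (\<lambda>a. [a]) (d0_if_odd n) @
        map (\<lambda>i. [Idx (int i), Idx (int (Suc i))]) [0..<m] @ map (\<lambda>a. [a]) vs)"
    by (intro hirota_pf_consecutive_sums[OF skew len])
  \<comment> \<open>The minus sign is the entry of \<open>Zsym (- 1)\<close> with
    \<open>Idx 0\<close>.\<close>
  then have "hirota_pf ?e (Zsym (- 1) # d0_if_odd n @ idx (Suc m) @ vs) =
      - ((-1) ^ n * hirota_pf (formal_sum_entry ?e)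
        (map shift_symbol (d0_if_odd n @ idx m) @ map (\<lambda>a. [a]) vs))"
    unfolding map_shift_symbol append_assoc idx_def[symmetric] minus_one_power_length_d0 by simp
  then show ?thesis by simp
qed

lemma tau_shift:
  assumes skew: "skew_entries \<omega>"
    and mu: "\<And>i j k l. integrable lebesgue (mu_integrand \<omega> \<rho> i j k l)"
    and beta: "\<And>i k l. integrable lebesgue (beta_integrand \<rho> i k l)"
  shows "tau \<omega> \<rho> (int n) (k - 1) (Suc l) =
    - ((-1) ^ n * hirota_pf (entry \<omega> \<rho> k l) (Zsym (- 1) # d0_if_odd n @ idx (Suc n)))"
proof -
  have "tau \<omega> \<rho> (int n) (k - 1) (Suc l) =
      hirota_pf (formal_sum_entry (entry \<omega> \<rho> k l)) (map shift_symbol (d0_if_odd n @ idx n))"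
    unfolding tau_int by (intro hirota_pf_cong entry_shift[OF mu beta] symbols_not_Zsym)
  then show ?thesis
    using hirota_pf_shift_symbol[OF skew_entries_entry[OF skew mu], of n n "[]"] by simp
qed

text \<open>The factor \<open>z + 1\<close> is absorbed by the row of \<open>Zsym z\<close>, which
  releases a factor \<open>z\<close>; hence \<open>z ^ Suc n\<close> instead of
  \<open>z ^ n\<close>.\<close>

lemma P_val_shift:
  assumes skew: "skew_entries \<omega>"
    and mu: "\<And>i j k l. integrable lebesgue (mu_integrand \<omega> \<rho> i j k l)"
    and beta: "\<And>i k l. integrable lebesgue (beta_integrand \<rho> i k l)"
    and "z \<noteq> 0" "tau \<omega> \<rho> (int n) (k - 1) (Suc l) \<noteq> 0"
  shows "tau \<omega> \<rho> (int n) (k - 1) (Suc l) * (z + 1) * P_val \<omega> \<rho> (int n) (k - 1) (Suc l) z =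
    - ((-1) ^ n * z ^ Suc n *
      hirota_pf (entry \<omega> \<rho> k l) (Zsym (- 1) # d0_if_odd n @ idx (Suc (Suc n)) @ [Zsym z]))"
proof -
  let ?e = "entry \<omega> \<rho> k l" and ?e' = "entry \<omega> \<rho> (k - 1) (Suc l)"
  let ?as = "d0_if_odd n @ idx (Suc n)"
  note skew_entries = skew_entries_entry[OF skew mu]
  have len: "odd (length ?as)" by simp
  have "(z + 1) * hirota_pf ?e' (?as @ [Zsym z]) = - ((z + 1) * hirota_pf ?e' (Zsym z # ?as))"
    by (simp only: hirota_pf_append1[OF len] mult_minus_right)
  also have "(z + 1) * hirota_pf ?e' (Zsym z # ?as) =
      z * hirota_pf (formal_sum_entry ?e) ([Zsym z] # map shift_symbol ?as)"
    using assms(4) by (intro hirota_pf_Cons_scale skew_entries skew_formal_sum_entry len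
      entry_shift[OF mu beta] entry_shift_Zsym symbols_not_Zsym)
  also have "- \<dots> = z * hirota_pf (formal_sum_entry ?e) (map shift_symbol ?as @ [[Zsym z]])"
    using hirota_pf_append1[of "map shift_symbol ?as" "formal_sum_entry ?e" "[Zsym z]"] len by simp
  also have "\<dots> = - ((-1) ^ n * z * hirota_pf ?e (Zsym (- 1) # d0_if_odd n @ idx (Suc (Suc n)) @ [Zsym z]))"
    using hirota_pf_shift_symbol[OF skew_entries, of n "Suc n" "[Zsym z]"] by simp
  finally have "(z + 1) * hirota_pf ?e' (d0_if_odd n @ idx (Suc n) @ [Zsym z]) =
      - ((-1) ^ n * z * hirota_pf ?e (Zsym (- 1) # d0_if_odd n @ idx (Suc (Suc n)) @ [Zsym z]))"
    by simp
  moreover have "tau \<omega> \<rho> (int n) (k - 1) (Suc l) * (z + 1) * P_val \<omega> \<rho> (int n) (k - 1) (Suc l) z =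
      z ^ n * ((z + 1) * hirota_pf ?e' (d0_if_odd n @ idx (Suc n) @ [Zsym z]))"
    using assms(5) by (simp add: P_val_int)
  ultimately show ?thesis by simp
qed

text \<open>This replaces the missing term with \<open>P\<^sub>-\<^sub>1\<close> when \<open>n = 0\<close>.\<close>

lemma hirota_pf_initial:
  assumes "skew_entries (entry \<omega> \<rho> k l)"
  shows "hirota_pf (entry \<omega> \<rho> k l) [Zsym y, D0, Idx i, Zsym z] = 0"
proof -
  have "hirota_pf (entry \<omega> \<rho> k l) [D0, Zsym z] = 0"
    using hirota_pf_Cons_single[OF assms, of "[]" D0 "Zsym z"] by simp
  \<comment> \<open>In this order \<open>Zsym y\<close> pairs only with its neighbour
    \<open>Idx i\<close>, leaving \<open>[D0, Zsym z]\<close>.\<close>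
  then have "hirota_pf (entry \<omega> \<rho> k l) [Zsym y, Idx i, D0, Zsym z] = 0"
    by (subst hirota_pf_Cons_single[OF assms]) auto
  then show ?thesis
    using hirota_pf_swap[of "[Zsym y]" "[Zsym z]" "entry \<omega> \<rho> k l" D0 "Idx i"] by simp
qed

section \<open>From values to polynomials, and the recurrence\<close>

text \<open>Multiplying the difference by the polynomial \<open>[:0, 1:]\<close> makes it vanish at
  \<open>0\<close> too.\<close>

lemma poly_eq_if_eq_nonzero:
  fixes p q :: "real poly"
  assumes "\<And>z. z \<noteq> 0 \<Longrightarrow> poly p z = poly q z"
  shows "p = q"
proof -
  have "poly ([:0, 1:] * (p - q)) z = 0" for z
    using assms[of z] by (cases "z = 0") auto
  then have "[:0, 1:] * (p - q) = 0"
    using poly_all_0_iff_0 by blast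
  then show ?thesis by simp
qed

theorem corollary4p2:
  fixes \<omega> :: "real \<Rightarrow> real \<Rightarrow> real" and \<rho> :: "real \<Rightarrow> real" and n k :: int and l :: nat
  assumes skew: "\<And>x y. \<omega> x y = - \<omega> y x"
    and mu_converges: "\<And>(i::int) (j::int) (k::int) (l::nat). integrable lebesgue (mu_integrand \<omega> \<rho> i j k l)"
    and beta_converges: "\<And>(i::int) (k::int) (l::nat). integrable lebesgue (beta_integrand \<rho> i k l)"
    and tau_nonzero: "\<And>(n::int) (k::int) (l::nat). n \<ge> 0 \<Longrightarrow> k \<ge> 0 \<Longrightarrow> tau \<omega> \<rho> n k l \<noteq> 0"
    and "n \<ge> 0" and "k \<ge> 1"
  shows "P_poly \<omega> \<rho> (n + 1) k l =
      [:1, 1:] * P_poly \<omega> \<rho> n (k - 1) (l + 1)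
      - [:0, 1:] * smult ((tau \<omega> \<rho> n k l * tau \<omega> \<rho> (n + 1) (k - 1) (l + 1))
                   / (tau \<omega> \<rho> n (k - 1) (l + 1) * tau \<omega> \<rho> (n + 1) k l))
          (P_poly \<omega> \<rho> n k l)
      + [:0, 1:] * [:1, 1:] * smult ((tau \<omega> \<rho> (n + 2) k l * tau \<omega> \<rho> (n - 1) (k - 1) (l + 1))
                   / (tau \<omega> \<rho> n (k - 1) (l + 1) * tau \<omega> \<rho> (n + 1) k l))
          (P_poly \<omega> \<rho> (n - 1) (k - 1) (l + 1))"
proof (rule poly_eq_if_eq_nonzero)
  fix z :: real assume z: "z \<noteq> 0"
  have skew_\<omega>: "skew_entries \<omega>"
    unfolding skew_entries_def using skew by blast
  obtain m where m: "n = int m" using \<open>n \<ge> 0\<close> nonneg_int_cases by blast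
  let ?e = "entry \<omega> \<rho> k l" and ?s = "(-1) ^ m :: real"
  let ?T = "\<lambda>n. tau \<omega> \<rho> n k l" and ?T' = "\<lambda>n. tau \<omega> \<rho> n (k - 1) (Suc l)"
  let ?P = "\<lambda>n. poly (P_poly \<omega> \<rho> n k l) z" and ?P' = "\<lambda>n. poly (P_poly \<omega> \<rho> n (k - 1) (Suc l)) z"
  let ?C = "Zsym (- 1)"
  have nz: "?T (int j) \<noteq> 0" "?T' (int j) \<noteq> 0" for j
    using tau_nonzero[of "int j" k l] tau_nonzero[of "int j" "k - 1" "Suc l"] \<open>k \<ge> 1\<close> by simp_all
  note skew_e = skew_entries_entry[OF skew_\<omega> mu_converges, where k = k and l = l]
  note T'_shift = tau_shift[OF skew_\<omega> mu_converges beta_converges, where k = k and l = l]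
  have TP: "?T (int j) * ?P (int j) = z ^ j * hirota_pf ?e (d0_if_odd j @ idx (Suc j) @ [Zsym z])" for j
    using nz(1)[of j] z by (simp add: poly_P_poly P_val_int)
  have TP': "?T' (int j) * ((z + 1) * ?P' (int j)) =
      - ((-1) ^ j * z ^ Suc j * hirota_pf ?e (?C # d0_if_odd j @ idx (Suc (Suc j)) @ [Zsym z]))" for j
    using P_val_shift[OF skew_\<omega> mu_converges beta_converges z nz(2)[of j]]
    by (simp only: poly_P_poly[OF of_nat_0_le_iff z] mult.assoc)
  \<comment> \<open>For \<open>m = 0\<close> both sides are zero, by the convention for
    \<open>\<tau>\<close> at \<open>-1\<close> and by \<open>hirota_pf_initial\<close>. Otherwise
    \<open>m - 1\<close> and \<open>m + 1\<close> have the same parity, and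
    \<open>(-1) ^ (m - 1)\<close> cancels the minus sign of \<open>TP'\<close>.\<close>
  have prev: "?T' (int m - 1) * (z * (z + 1) * ?P' (int m - 1)) =
      ?s * z ^ Suc m * hirota_pf ?e (?C # d0_if_odd (Suc m) @ idx (Suc m) @ [Zsym z])"
  proof (cases m)
    case 0
    then show ?thesis
      using hirota_pf_initial[OF skew_e, of "- 1" 0 z] by (simp add: tau_def d0_if_odd_def idx_def)
  next
    case (Suc j)
    have "?T' (int j) * (z * (z + 1) * ?P' (int j)) = z * (?T' (int j) * ((z + 1) * ?P' (int j)))"
      by (simp only: mult_ac)
    then show ?thesis
      unfolding TP' by (simp add: Suc)
  qed
  \<comment> \<open>The relation of \<open>hirota_pf_recurrence\<close> times
    \<open>- (s * z * w)\<close>, where \<open>s\<close> and \<open>w\<close> stand for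
    \<open>(-1) ^ m\<close> and \<open>z ^ m\<close>; the signs appear as the shift lemmas produce
    them.\<close>
  have scale: "- (s * x) * (z * w * p) = t * - (s * (z * w) * y) - z * - (- 1 * s * x') * (w * q) +
      t' * (s * (z * w) * y')" if "x * p = t * y + x' * q - t' * y'" for s x w p t y x' q t' y' :: real
  proof -
    have "- (s * x) * (z * w * p) = - (s * z * w) * (x * p)" by simp
    then show ?thesis unfolding that by (simp add: algebra_simps)
  qed
  \<comment> \<open>Division by \<open>d' * d\<close>, which will be
    \<open>?T' (int m) * ?T (int (Suc m))\<close>.\<close>
  have solve: "p = (z + 1) * a - z * ((x * x') / (d' * d) * b) + z * (z + 1) * ((y * y') / (d' * d) * c)"
    if "d' * (d * p) = d * (d' * ((z + 1) * a)) - z * x' * (x * b) + y * (y' * (z * (z + 1) * c))"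
      "d' \<noteq> 0" "d \<noteq> 0" for d d' p a b c x x' y y' :: real
  proof -
    have "p = (d' * (d * p)) / (d' * d)" using that(2,3) by simp
    then show ?thesis
      unfolding that(1) using that(2,3) by (simp add: add_divide_distrib diff_divide_distrib mult_ac)
  qed
  have "?T' (int m) * (?T (int (Suc m)) * ?P (int (Suc m))) =
      ?T (int (Suc m)) * (?T' (int m) * ((z + 1) * ?P' (int m)))
      - z * ?T' (int (Suc m)) * (?T (int m) * ?P (int m))
      + ?T (int (Suc (Suc m))) * (?T' (int m - 1) * (z * (z + 1) * ?P' (int m - 1)))"
    \<comment> \<open>The order matters: products with \<open>?P\<close> and \<open>?P'\<close>
      first, then the remaining \<open>?T'\<close>, and \<open>?T\<close> last.\<close>
    unfolding TP TP' prev unfolding T'_shift unfolding tau_int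
    unfolding d0_if_odd_Suc_Suc power_Suc
    by (rule scale[OF hirota_pf_recurrence[OF skew_e]])
  then have "?P (int (Suc m)) = (z + 1) * ?P' (int m)
      - z * ((?T (int m) * ?T' (int (Suc m))) / (?T' (int m) * ?T (int (Suc m))) * ?P (int m))
      + z * (z + 1) * ((?T (int (Suc (Suc m))) * ?T' (int m - 1)) / (?T' (int m) * ?T (int (Suc m))) *
        ?P' (int m - 1))"
    using nz by (intro solve)
  moreover have "int (Suc m) = int m + 1" "int (Suc (Suc m)) = int m + 2" by simp_all
  ultimately show "poly (P_poly \<omega> \<rho> (n + 1) k l) z = poly (
      [:1, 1:] * P_poly \<omega> \<rho> n (k - 1) (l + 1)
      - [:0, 1:] * smult ((tau \<omega> \<rho> n k l * tau \<omega> \<rho> (n + 1) (k - 1) (l + 1))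
                   / (tau \<omega> \<rho> n (k - 1) (l + 1) * tau \<omega> \<rho> (n + 1) k l))
          (P_poly \<omega> \<rho> n k l)
      + [:0, 1:] * [:1, 1:] * smult ((tau \<omega> \<rho> (n + 2) k l * tau \<omega> \<rho> (n - 1) (k - 1) (l + 1))
                   / (tau \<omega> \<rho> n (k - 1) (l + 1) * tau \<omega> \<rho> (n + 1) k l))
          (P_poly \<omega> \<rho> (n - 1) (k - 1) (l + 1))) z"
    by (simp add: m algebra_simps)
qed

end
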